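(* Let $k$ be a constant and let $\varphi:(M^2,g=dr^2+\sigma^2(r)d\theta^2)\longrightarrow (N^2,h=d\rho^2+\lambda^2(\rho)d\phi^2)$ be a rotationally symmetric map $\varphi(r,\theta)=(\rho(r),k\theta)$. Let $f=f(r,\theta)$ be a positive smooth function on $M^2$. Then the map $\varphi:(M^2,\bar g=f^{-1}g)\longrightarrow(N^2,h)$ is biharmonic if and only if $f$ solves the system $$\begin{cases}\Delta(xf)=\dfrac{k^2(\lambda\lambda')'(\rho)}{\sigma^2}\,(xf),\\[4pt] \dfrac{k f_\theta\,\lambda'(\rho)\,x}{\sigma^2\lambda(\rho)}=0,\\[4pt] x=\Delta\rho-\dfrac{k^2\lambda(\rho)\lambda'(\rho)}{\sigma^2},\end{cases}$$ where $\Delta$ denotes the Laplacian on functions with respect to $g$ and $\rho=\rho(r)$. In particular, when $f=f(r)$ depends only on $r$, the map $\varphi:(M^2,\bar g=f^{-1}g)\longrightarrow(N^2,h)$ is biharmonic if and only if $f$ solves $$\begin{cases} y''+\dfrac{\sigma'}{\sigma}y'-\dfrac{k^2(\lambda\lambda')'(\rho)}{\sigma^2}\,y=0,\\[4pt] y=fx,\\[4pt] x=\rho''+\dfrac{\sigma'}{\sigma}\rho'-\dfrac{k^2\lambda(\rho)\lambda'(\rho)}{\sigma^2},\end{cases}$$ where primes on $y,\rho,\sigma$ are derivatives with respect to $r$.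
   Context: For a smooth map $\phi:(M,g)\to(N,h)$ of Riemannian manifolds, $\tau(\phi)=\mathrm{Tr}_g\nabla d\phi$ is the tension field and $\tau_2(\phi)=\mathrm{Trace}_g(\nabla^\phi\nabla^\phi-\nabla^\phi_{\nabla^M})\tau(\phi)-\mathrm{Trace}_g R^N(d\phi,\tau(\phi))d\phi$ is the bitension field, with $R^N(X,Y)Z=[\nabla^N_X,\nabla^N_Y]Z-\nabla^N_{[X,Y]}Z$. The map is harmonic if $\tau(\phi)=0$ and biharmonic if $\tau_2(\phi)=0$. Here $(r,\theta)$ and $(\rho,\phi)$ are polar-type coordinates on $M^2$, $N^2$ ($\theta,\phi$ angular), $\sigma$ and $\lambda$ are positive smooth functions of one variable, $\lambda'=d\lambda/d\rho$, and $(\lambda\lambda')'(\rho)$ is the derivative of $\lambda\lambda'$ with respect to $\rho$, evaluated at $\rho=\rho(r)$. When $k$ is not an integer the statement is understood in local coordinates (locally in $\theta$). *)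

theory Defs
  imports "HOL-Analysis.Analysis"
begin

text \<open>
  Riemannian geometry in coordinate patches. A patch is an open subset of \<open>real ^ 'm\<close>; a metric is
  its matrix field \<open>x \<mapsto> (g\<^sub>i\<^sub>j(x))\<close> in these coordinates; vector fields on the patch and sections of
  a pullback bundle are given by their coordinate components. All functions are total in the logic,
  but at a point of an open patch the operators below only depend on the values in that patch.
\<close>

primrec Ck_on :: "nat \<Rightarrow> ('a::real_normed_vector \<Rightarrow> 'b::real_normed_vector) \<Rightarrow> 'a set \<Rightarrow> bool" where
  "Ck_on 0 u U \<longleftrightarrow> continuous_on U u"
| "Ck_on (Suc n) u U \<longleftrightarrow>
     (\<forall>x\<in>U. u differentiable (at x)) \<and> (\<forall>v. Ck_on n (\<lambda>x. frechet_derivative u (at x) v) U)"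

text \<open>Meant for open \<open>U\<close> only, since derivatives are taken at full neighbourhoods.\<close>

definition smooth_on :: "('a::real_normed_vector \<Rightarrow> 'b::real_normed_vector) \<Rightarrow> 'a set \<Rightarrow> bool" where
  "smooth_on u U \<longleftrightarrow> (\<forall>n. Ck_on n u U)"

definition dir_deriv ::
    "(real ^ 'm \<Rightarrow> real ^ 'm) \<Rightarrow> (real ^ 'm \<Rightarrow> 'b::real_normed_vector) \<Rightarrow> real ^ 'm \<Rightarrow> 'b" where
  "dir_deriv X u x = frechet_derivative u (at x) (X x)"

definition coord_field :: "'m \<Rightarrow> real ^ 'm \<Rightarrow> real ^ ('m::finite)" where
  "coord_field i = (\<lambda>x. axis i 1)"

abbreviation partial_deriv ::
    "'m \<Rightarrow> (real ^ 'm \<Rightarrow> 'b::real_normed_vector) \<Rightarrow> real ^ ('m::finite) \<Rightarrow> 'b" where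
  "partial_deriv i \<equiv> dir_deriv (coord_field i)"

text \<open>\<open>christoffel g k i j\<close> is the symbol with upper index \<open>k\<close> and lower indices \<open>i\<close>, \<open>j\<close>.\<close>

definition christoffel ::
    "(real ^ 'm \<Rightarrow> real ^ 'm ^ 'm) \<Rightarrow> 'm \<Rightarrow> 'm \<Rightarrow> 'm \<Rightarrow> real ^ ('m::finite) \<Rightarrow> real" where
  "christoffel g k i j x =
     (\<Sum>l\<in>UNIV. matrix_inv (g x) $ k $ l *
        (partial_deriv i (\<lambda>z. g z $ j $ l) x + partial_deriv j (\<lambda>z. g z $ i $ l) x
         - partial_deriv l (\<lambda>z. g z $ i $ j) x)) / 2"

definition christoffel_form ::
    "(real ^ 'm \<Rightarrow> real ^ 'm ^ 'm) \<Rightarrow> real ^ 'm \<Rightarrow> real ^ 'm \<Rightarrow> real ^ 'm \<Rightarrow> real ^ ('m::finite)" where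
  "christoffel_form g x v w =
     (\<chi> k. \<Sum>i\<in>UNIV. \<Sum>j\<in>UNIV. christoffel g k i j x * v $ i * w $ j)"

definition levi_civita ::
    "(real ^ 'm \<Rightarrow> real ^ 'm ^ 'm) \<Rightarrow> (real ^ 'm \<Rightarrow> real ^ 'm) \<Rightarrow> (real ^ 'm \<Rightarrow> real ^ 'm) \<Rightarrow>
      real ^ 'm \<Rightarrow> real ^ ('m::finite)" where
  "levi_civita g X Y x = dir_deriv X Y x + christoffel_form g x (X x) (Y x)"

definition lie_bracket ::
    "(real ^ 'm \<Rightarrow> real ^ 'm) \<Rightarrow> (real ^ 'm \<Rightarrow> real ^ 'm) \<Rightarrow> real ^ 'm \<Rightarrow> real ^ ('m::finite)" where
  "lie_bracket X Y x = dir_deriv X Y x - dir_deriv Y X x"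

definition curvature ::
    "(real ^ 'm \<Rightarrow> real ^ 'm ^ 'm) \<Rightarrow> (real ^ 'm \<Rightarrow> real ^ 'm) \<Rightarrow> (real ^ 'm \<Rightarrow> real ^ 'm) \<Rightarrow>
      (real ^ 'm \<Rightarrow> real ^ 'm) \<Rightarrow> real ^ 'm \<Rightarrow> real ^ ('m::finite)" where
  "curvature g X Y Z x =
     levi_civita g X (levi_civita g Y Z) x - levi_civita g Y (levi_civita g X Z) x
     - levi_civita g (lie_bracket X Y) Z x"

text \<open>
  The curvature is tensorial, so its value on tangent vectors at a point is computed from any
  extensions to vector fields; we take those with constant coordinate components.
\<close>

definition curvature_at ::
    "(real ^ 'm \<Rightarrow> real ^ 'm ^ 'm) \<Rightarrow> real ^ 'm \<Rightarrow> real ^ 'm \<Rightarrow> real ^ 'm \<Rightarrow> real ^ 'm \<Rightarrow>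
      real ^ ('m::finite)" where
  "curvature_at g x u v w = curvature g (\<lambda>_. u) (\<lambda>_. v) (\<lambda>_. w) x"

text \<open>Trace of a bilinear expression given by its values \<open>B i j\<close> on the coordinate fields.\<close>

definition metric_trace ::
    "(real ^ 'm \<Rightarrow> real ^ 'm ^ 'm) \<Rightarrow> real ^ 'm \<Rightarrow> ('m::finite \<Rightarrow> 'm \<Rightarrow> 'b::real_vector) \<Rightarrow> 'b" where
  "metric_trace g x B = (\<Sum>i\<in>UNIV. \<Sum>j\<in>UNIV. (matrix_inv (g x) $ i $ j) *\<^sub>R B i j)"

definition laplacian ::
    "(real ^ 'm \<Rightarrow> real ^ 'm ^ 'm) \<Rightarrow> (real ^ 'm \<Rightarrow> real) \<Rightarrow> real ^ ('m::finite) \<Rightarrow> real" where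
  "laplacian g u x = metric_trace g x
     (\<lambda>i j. partial_deriv i (partial_deriv j u) x
        - dir_deriv (levi_civita g (coord_field i) (coord_field j)) u x)"

text \<open>The connection induced by \<open>h\<close> on the pullback bundle of a map \<open>\<phi>\<close>.\<close>

definition pullback_conn ::
    "(real ^ 'n \<Rightarrow> real ^ 'n ^ 'n) \<Rightarrow> (real ^ 'm \<Rightarrow> real ^ 'n) \<Rightarrow> (real ^ 'm \<Rightarrow> real ^ 'm) \<Rightarrow>
      (real ^ 'm \<Rightarrow> real ^ 'n) \<Rightarrow> real ^ ('m::finite) \<Rightarrow> real ^ ('n::finite)" where
  "pullback_conn h \<phi> X V x =
     dir_deriv X V x + christoffel_form h (\<phi> x) (dir_deriv X \<phi> x) (V x)"

text \<open>\<open>\<nabla>d\<phi>(X, Y)\<close>; note that \<open>dir_deriv Y \<phi>\<close> is \<open>d\<phi>(Y)\<close>, as a section along \<open>\<phi>\<close>.\<close>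

definition second_fundamental_form ::
    "(real ^ 'm \<Rightarrow> real ^ 'm ^ 'm) \<Rightarrow> (real ^ 'n \<Rightarrow> real ^ 'n ^ 'n) \<Rightarrow> (real ^ 'm \<Rightarrow> real ^ 'n) \<Rightarrow>
      (real ^ 'm \<Rightarrow> real ^ 'm) \<Rightarrow> (real ^ 'm \<Rightarrow> real ^ 'm) \<Rightarrow>
      real ^ ('m::finite) \<Rightarrow> real ^ ('n::finite)" where
  "second_fundamental_form g h \<phi> X Y x =
     pullback_conn h \<phi> X (dir_deriv Y \<phi>) x - dir_deriv (levi_civita g X Y) \<phi> x"

definition tension ::
    "(real ^ 'm \<Rightarrow> real ^ 'm ^ 'm) \<Rightarrow> (real ^ 'n \<Rightarrow> real ^ 'n ^ 'n) \<Rightarrow> (real ^ 'm \<Rightarrow> real ^ 'n) \<Rightarrow>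
      real ^ ('m::finite) \<Rightarrow> real ^ ('n::finite)" where
  "tension g h \<phi> x = metric_trace g x
     (\<lambda>i j. second_fundamental_form g h \<phi> (coord_field i) (coord_field j) x)"

definition bitension ::
    "(real ^ 'm \<Rightarrow> real ^ 'm ^ 'm) \<Rightarrow> (real ^ 'n \<Rightarrow> real ^ 'n ^ 'n) \<Rightarrow> (real ^ 'm \<Rightarrow> real ^ 'n) \<Rightarrow>
      real ^ ('m::finite) \<Rightarrow> real ^ ('n::finite)" where
  "bitension g h \<phi> x =
     metric_trace g x
       (\<lambda>i j. pullback_conn h \<phi> (coord_field i)
                  (pullback_conn h \<phi> (coord_field j) (tension g h \<phi>)) x
              - pullback_conn h \<phi> (levi_civita g (coord_field i) (coord_field j))
                  (tension g h \<phi>) x)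
     - metric_trace g x
       (\<lambda>i j. curvature_at h (\<phi> x) (partial_deriv i \<phi> x) (tension g h \<phi> x)
                  (partial_deriv j \<phi> x))"

text \<open>Meant for open \<open>U\<close> and \<open>\<phi>\<close>, \<open>g\<close> smooth on \<open>U\<close>, \<open>h\<close> smooth near \<open>\<phi> ` U\<close>.\<close>

definition biharmonic_on ::
    "(real ^ 'm) set \<Rightarrow> (real ^ 'm \<Rightarrow> real ^ 'm ^ 'm) \<Rightarrow> (real ^ 'n \<Rightarrow> real ^ 'n ^ 'n) \<Rightarrow>
      (real ^ ('m::finite) \<Rightarrow> real ^ ('n::finite)) \<Rightarrow> bool" where
  "biharmonic_on U g h \<phi> \<longleftrightarrow> (\<forall>x\<in>U. bitension g h \<phi> x = 0)"

text \<open>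
  Polar-type coordinates on a surface: component 1 is the radial and component 2 the angular
  coordinate. The angular range \<open>J\<close> may be all of \<open>\<real>\<close>; a surface with a full circle of angles is
  then described by data that are periodic in component 2.
\<close>

definition polar_patch :: "real set \<Rightarrow> real set \<Rightarrow> (real ^ 2) set" where
  "polar_patch I J = {x. x $ 1 \<in> I \<and> x $ 2 \<in> J}"

definition polar_metric :: "(real \<Rightarrow> real) \<Rightarrow> real ^ 2 \<Rightarrow> real ^ 2 ^ 2" where
  "polar_metric s x = vector [vector [1, 0], vector [0, (s (x $ 1))\<^sup>2]]"

definition conformal_metric ::
    "(real ^ 'm \<Rightarrow> real) \<Rightarrow> (real ^ 'm \<Rightarrow> real ^ 'm ^ 'm) \<Rightarrow> real ^ ('m::finite) \<Rightarrow> real ^ 'm ^ 'm" where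
  "conformal_metric c g x = c x *\<^sub>R g x"

definition rot_sym_map :: "(real \<Rightarrow> real) \<Rightarrow> real \<Rightarrow> real ^ 2 \<Rightarrow> real ^ 2" where
  "rot_sym_map \<rho> k x = vector [\<rho> (x $ 1), k * x $ 2]"

end

theory Submission
  imports Defs
begin

text \<open>
  In dimension two the contracted second derivatives in the tension and bitension fields scale by
  \<open>f\<close> when the domain metric \<open>g\<close> is replaced by \<open>g / f\<close>: the first order terms that a conformal change
  introduces cancel in the trace (\<open>metric_trace_minus_connection\<close>). Hence the tension field becomes
  \<open>f\<close> times the one for \<open>g\<close>. For a rotationally symmetric map the latter is radial, with component
  \<open>x = \<rho>'' + \<sigma>' \<rho>' / \<sigma> - k\<^sup>2 lam lam' / \<sigma>\<^sup>2\<close>, so the new tension field is \<open>(y, 0)\<close> with \<open>y = x f\<close>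
  (\<open>tension_conformal\<close>).

  The bitension field is \<open>f\<close> times the Jacobi operator of \<open>g\<close> applied to \<open>(y, 0)\<close>. Along the circles of
  constant \<open>r\<close> the pullback connection rotates the radial direction with speed \<open>k lam'\<close> (in orthonormal
  frames). Its square contributes \<open>- k\<^sup>2 lam'\<^sup>2 y / \<sigma>\<^sup>2\<close> to the radial component, and twice its product with
  the angular derivative of \<open>y\<close> is the whole angular component. The curvature of the target contributes
  \<open>- k\<^sup>2 lam lam'' y / \<sigma>\<^sup>2\<close>. As \<open>lam'\<^sup>2 + lam lam'' = (lam lam')'\<close>, the two components are the first two
  equations of the system, up to the nonzero factors \<open>f\<close> and \<open>2 f\<close> (\<open>bitension_conformal\<close>); since \<open>x\<close>
  depends on \<open>r\<close> alone, \<open>y\<^sub>\<theta> = x f\<^sub>\<theta>\<close>.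

  If \<open>f\<close> is radial, the angular equation holds trivially and the Laplacian of \<open>y\<close> is \<open>y'' + \<sigma>' y' / \<sigma>\<close>, which
  gives the ordinary differential equation.
\<close>

section \<open>Derivatives on open patches\<close>

lemma coord_field_component [simp]: "coord_field i p $ j = (if j = i then 1 else 0)"
  by (simp add: coord_field_def axis_def)

lemma has_derivative_vector_2:
  fixes a b :: "'a::real_normed_vector \<Rightarrow> real"
  assumes "(a has_derivative a') (at p)" "(b has_derivative b') (at p)"
  shows "((\<lambda>q. vector [a q, b q] :: real ^ 2) has_derivative (\<lambda>v. vector [a' v, b' v])) (at p)"
proof -
  have *: "vector [s, t] = s *\<^sub>R axis 1 1 + t *\<^sub>R (axis 2 1 :: real ^ 2)" for s t :: real
    by (simp add: vec_eq_iff forall_2 axis_def)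
  show ?thesis
    unfolding * using assms by (auto intro!: derivative_eq_intros)
qed

lemma dir_deriv_eq:
  assumes "(u has_derivative u') (at p)"
  shows "dir_deriv X u p = u' (X p)"
  using frechet_derivative_at[OF assms] by (simp add: dir_deriv_def)

text \<open>
  Every operator of the geometry is local. This is what allows a field that is only known on the
  patch, such as the tension field, to be replaced there by an explicit formula before it is
  differentiated again. The identity also holds where no derivative exists, since both sides choose
  from the same set of derivatives.
\<close>

lemma dir_deriv_cong:
  assumes "open U" "p \<in> U" "\<And>q. q \<in> U \<Longrightarrow> u q = v q"
  shows "dir_deriv X u p = dir_deriv X v p"
proof -
  have "(u has_derivative D) (at p) \<longleftrightarrow> (v has_derivative D) (at p)" for D
    using has_derivative_transform_within_open[where f = u and g = v, OF _ assms(1,2)]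
      has_derivative_transform_within_open[where f = v and g = u, OF _ assms(1,2)] assms(3) by auto
  then show ?thesis
    by (simp add: dir_deriv_def frechet_derivative_def)
qed

lemma deriv_cong_open:
  fixes u v :: "real \<Rightarrow> real"
  assumes "open U" "p \<in> U" "\<And>q. q \<in> U \<Longrightarrow> u q = v q"
  shows "deriv u p = deriv v p"
  using eventually_nhds_in_open[OF assms(1,2)]
  by (intro deriv_cong_ev) (auto elim!: eventually_mono simp: assms(3))

lemma Ck_on_cong:
  assumes "open U" "\<And>q. q \<in> U \<Longrightarrow> u q = v q" "Ck_on n u U"
  shows "Ck_on n v U"
  using assms(2,3)
proof (induction n arbitrary: u v)
  case 0
  then show ?case by (simp cong: continuous_on_cong)
next
  case (Suc n)
  have d: "(v has_derivative D) (at x)" if "x \<in> U" "(u has_derivative D) (at x)" for x D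
    using has_derivative_transform_within_open[OF that(2) \<open>open U\<close> that(1)] Suc.prems(1) by auto
  have "v differentiable (at x)" if "x \<in> U" for x
    using d[OF that] Suc.prems(2) that unfolding Ck_on.simps differentiable_def by blast
  moreover have "Ck_on n (\<lambda>x. frechet_derivative v (at x) w) U" for w
  proof (rule Suc.IH)
    show "Ck_on n (\<lambda>x. frechet_derivative u (at x) w) U" using Suc.prems(2) by simp
    show "frechet_derivative u (at x) w = frechet_derivative v (at x) w" if "x \<in> U" for x
    proof -
      have "(u has_derivative frechet_derivative u (at x)) (at x)"
        using Suc.prems(2) that by (simp add: frechet_derivative_works[symmetric])
      from frechet_derivative_at[OF d[OF that this]] show ?thesis by simp
    qed
  qed
  ultimately show ?case by simp
qed

lemma smooth_on_DERIV:
  fixes u :: "real \<Rightarrow> real"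
  assumes "smooth_on u I" "r \<in> I"
  shows "(u has_real_derivative deriv u r) (at r)"
proof -
  have "Ck_on (Suc 0) u I" using assms(1) by (simp only: smooth_on_def)
  then have "u differentiable (at r)" using assms(2) by simp
  then show ?thesis
    by (simp add: DERIV_deriv_iff_real_differentiable)
qed

lemma smooth_on_deriv:
  fixes u :: "real \<Rightarrow> real"
  assumes "open I" "smooth_on u I"
  shows "smooth_on (deriv u) I"
  unfolding smooth_on_def
proof
  fix n
  have "Ck_on (Suc n) u I" using assms(2) by (simp only: smooth_on_def)
  then have "Ck_on n (\<lambda>x. frechet_derivative u (at x) 1) I" by simp
  moreover have "frechet_derivative u (at x) 1 = deriv u x" if "x \<in> I" for x
    using arg_cong[OF frechet_derivative_at[OF
        smooth_on_DERIV[OF assms(2) that, unfolded has_field_derivative_def]], of "\<lambda>D. D 1"]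
    by simp
  ultimately show "Ck_on n (deriv u) I"
    by (rule Ck_on_cong[OF assms(1), rotated])
qed

lemma smooth_on_differentiable:
  assumes "smooth_on u U" "p \<in> U"
  shows "u differentiable (at p)"
proof -
  have "Ck_on (Suc 0) u U" using assms(1) by (simp only: smooth_on_def)
  then show ?thesis using assms(2) by simp
qed

lemma smooth_on_dir_deriv_const:
  assumes "smooth_on u U"
  shows "smooth_on (dir_deriv (\<lambda>_. v) u) U"
  unfolding smooth_on_def
proof
  fix n
  have "Ck_on (Suc n) u U" using assms by (simp only: smooth_on_def)
  then show "Ck_on n (dir_deriv (\<lambda>_. v) u) U" by (simp add: dir_deriv_def[abs_def])
qed

lemma has_derivative_radial:
  fixes p :: "real ^ 2" and u :: "real \<Rightarrow> real"
  assumes "(u has_real_derivative u') (at (p $ 1))"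
  shows "((\<lambda>q. u (q $ 1)) has_derivative (\<lambda>v. u' * v $ 1)) (at p)"
proof -
  have "((\<lambda>q::real^2. q $ 1) has_derivative (\<lambda>v. v $ 1)) (at p)"
    by (rule bounded_linear.has_derivative[OF bounded_linear_vec_nth]) simp
  from has_derivative_compose[OF this assms[unfolded has_field_derivative_def]]
  show ?thesis .
qed

section \<open>Diagonal metrics and the trace of the connection\<close>

lemma matrix_inv_diagonal:
  fixes a b :: real
  assumes "a \<noteq> 0" "b \<noteq> 0"
  shows "matrix_inv (vector [vector [a, 0], vector [0, b]] :: real ^ 2 ^ 2)
           = vector [vector [inverse a, 0], vector [0, inverse b]]"
proof -
  let ?A = "vector [vector [a, 0], vector [0, b]] :: real ^ 2 ^ 2"
  let ?B = "vector [vector [inverse a, 0], vector [0, inverse b]] :: real ^ 2 ^ 2"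
  have AB: "?A ** ?B = mat 1" "?B ** ?A = mat 1"
    using assms by (simp_all add: vec_eq_iff forall_2 matrix_matrix_mult_def sum_2 mat_def)
  then have "matrix_inv ?A ** ?A = mat 1"
    using someI[of "\<lambda>C. ?A ** C = mat 1 \<and> C ** ?A = mat 1" ?B] unfolding matrix_inv_def by blast
  have "matrix_inv ?A = matrix_inv ?A ** (?A ** ?B)" by (simp only: AB(1) matrix_mul_rid)
  also have "\<dots> = ?B" by (simp only: matrix_mul_assoc \<open>matrix_inv ?A ** ?A = mat 1\<close> matrix_mul_lid)
  finally show ?thesis .
qed

lemma dir_deriv_const [simp]: "dir_deriv X (\<lambda>_. c) p = 0"
  by (simp add: dir_deriv_def)

lemma christoffel_diagonal:
  fixes g :: "real ^ 2 \<Rightarrow> real ^ 2 ^ 2"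
  assumes g: "\<And>q. g q = vector [vector [a q, 0], vector [0, b q]]"
    and nz: "a p \<noteq> 0" "b p \<noteq> 0"
  shows "christoffel g 1 1 1 p = partial_deriv 1 a p / (2 * a p)"
    and "christoffel g 1 1 2 p = partial_deriv 2 a p / (2 * a p)"
    and "christoffel g 1 2 1 p = partial_deriv 2 a p / (2 * a p)"
    and "christoffel g 1 2 2 p = - partial_deriv 1 b p / (2 * a p)"
    and "christoffel g 2 1 1 p = - partial_deriv 2 a p / (2 * b p)"
    and "christoffel g 2 1 2 p = partial_deriv 1 b p / (2 * b p)"
    and "christoffel g 2 2 1 p = partial_deriv 1 b p / (2 * b p)"
    and "christoffel g 2 2 2 p = partial_deriv 2 b p / (2 * b p)"
  by (simp_all add: christoffel_def g matrix_inv_diagonal nz sum_2 divide_simps)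

lemma metric_trace_diagonal:
  fixes g :: "real ^ 2 \<Rightarrow> real ^ 2 ^ 2"
  assumes "g p = vector [vector [a, 0], vector [0, b]]" "a \<noteq> 0" "b \<noteq> 0"
  shows "metric_trace g p B = inverse a *\<^sub>R B 1 1 + inverse b *\<^sub>R B 2 2"
  using assms by (simp add: metric_trace_def matrix_inv_diagonal sum_2)

lemma levi_civita_coord_field:
  "levi_civita g (coord_field i) (coord_field j) p = (\<chi> k. christoffel g k i j p)"
proof -
  have "dir_deriv (coord_field i) (coord_field j) p = 0"
    unfolding coord_field_def by simp
  moreover have "t * (if P then 1 else 0) = (if P then t else 0)" for t :: real and P
    by simp
  ultimately show ?thesis
    by (simp add: levi_civita_def christoffel_form_def vec_eq_iff)
qed

lemma conformal_polar_metric_eq: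
  "conformal_metric c (polar_metric s) = (\<lambda>q. vector [vector [c q, 0], vector [0, c q * (s (q $ 1))\<^sup>2]])"
  by (simp add: conformal_metric_def polar_metric_def fun_eq_iff vec_eq_iff forall_2)

text \<open>
  Results on conformal changes thereby include the polar metric itself.
\<close>

lemma polar_metric_eq_conformal: "polar_metric s = conformal_metric (\<lambda>_. 1) (polar_metric s)"
  by (simp add: conformal_metric_def fun_eq_iff)

text \<open>
  The conformal invariance in dimension two, on which the whole computation rests. The trace of the
  Levi-Civita symbols of \<open>c (dr\<^sup>2 + s\<^sup>2 d\<theta>\<^sup>2)\<close> is \<open>- s' / (c s)\<close> times the radial field: the derivatives
  of \<open>c\<close> in the symbols with lower indices \<open>1 1\<close> and \<open>2 2\<close> cancel. So every operator of the form
  "trace of (second derivative minus derivative along the connection)" is multiplied by \<open>1 / c\<close>. The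
  linear map \<open>l\<close> is kept abstract because it is the differential of a function for the Laplacian, the
  differential of the map for the tension field, and the pullback connection for the bitension field.
\<close>

lemma metric_trace_minus_connection:
  fixes l :: "real ^ 2 \<Rightarrow> 'b::real_vector" and B :: "2 \<Rightarrow> 2 \<Rightarrow> 'b"
  assumes l: "linear l"
    and c: "c differentiable (at p)" "c p \<noteq> 0"
    and s: "(s has_real_derivative s') (at (p $ 1))" "s (p $ 1) \<noteq> 0"
  shows "metric_trace (conformal_metric c (polar_metric s)) p
           (\<lambda>i j. B i j - l (levi_civita (conformal_metric c (polar_metric s))
                                 (coord_field i) (coord_field j) p))
         = inverse (c p) *\<^sub>R
             (B 1 1 + inverse ((s (p $ 1))\<^sup>2) *\<^sub>R B 2 2 + (s' / s (p $ 1)) *\<^sub>R l (axis 1 1))"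
proof -
  let ?g = "conformal_metric c (polar_metric s)"
  let ?b = "\<lambda>q. c q * (s (q $ 1))\<^sup>2"
  define c' where "c' = frechet_derivative c (at p)"
  have dc: "(c has_derivative c') (at p)"
    using c(1) unfolding c'_def by (simp add: frechet_derivative_works)
  have db: "(?b has_derivative (\<lambda>v. c' v * (s (p $ 1))\<^sup>2 + c p * (2 * s (p $ 1) * s' * v $ 1))) (at p)"
    by (rule derivative_eq_intros dc has_derivative_radial[OF s(1)] refl)+
       (simp add: fun_eq_iff algebra_simps)
  have g: "?g q = vector [vector [c q, 0], vector [0, ?b q]]" for q
    by (simp add: conformal_polar_metric_eq)
  have nz: "?b p \<noteq> 0" using c s by simp
  note ch = christoffel_diagonal[of ?g c ?b p, OF g c(2) nz]
  let ?G = "\<lambda>i j. levi_civita ?g (coord_field i) (coord_field j) p"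
  have "inverse (c p) *\<^sub>R ?G 1 1 + inverse (?b p) *\<^sub>R ?G 2 2
      = - (inverse (c p) * (s' / s (p $ 1))) *\<^sub>R (axis 1 1 :: real ^ 2)"
    using c s nz
    by (simp add: levi_civita_coord_field vec_eq_iff forall_2 ch dir_deriv_eq[OF dc]
        dir_deriv_eq[OF db] axis_def)
       (simp add: field_simps power2_eq_square)
  from arg_cong[OF this, of l]
  have "inverse (c p) *\<^sub>R l (?G 1 1) + inverse (?b p) *\<^sub>R l (?G 2 2)
      = - ((inverse (c p) * (s' / s (p $ 1))) *\<^sub>R l (axis 1 1))"
    using l by (simp add: linear_add linear_scale linear_neg)
  then show ?thesis
    by (subst metric_trace_diagonal[of ?g p "c p" "?b p", OF g c(2) nz]) (simp add: algebra_simps)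
qed

lemma laplacian_polar:
  assumes "u differentiable (at p)"
    and s: "(s has_real_derivative s') (at (p $ 1))" "s (p $ 1) \<noteq> 0"
  shows "laplacian (polar_metric s) u p
     = partial_deriv 1 (partial_deriv 1 u) p + s' / s (p $ 1) * partial_deriv 1 u p
       + partial_deriv 2 (partial_deriv 2 u) p / (s (p $ 1))\<^sup>2"
proof -
  let ?l = "frechet_derivative u (at p)"
  have "laplacian (polar_metric s) u p = metric_trace (polar_metric s) p
     (\<lambda>i j. partial_deriv i (partial_deriv j u) p
        - ?l (levi_civita (polar_metric s) (coord_field i) (coord_field j) p))"
    unfolding laplacian_def dir_deriv_def[of "levi_civita _ _ _"] by (rule refl)
  also have "\<dots> = inverse 1 *\<^sub>R (partial_deriv 1 (partial_deriv 1 u) p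
      + inverse ((s (p $ 1))\<^sup>2) *\<^sub>R partial_deriv 2 (partial_deriv 2 u) p
      + (s' / s (p $ 1)) *\<^sub>R ?l (axis 1 1))"
    by (rule metric_trace_minus_connection[OF linear_frechet_derivative[OF assms(1)],
        where c = "\<lambda>_. 1" and B = "\<lambda>i j. partial_deriv i (partial_deriv j u) p", OF _ _ s,
        folded polar_metric_eq_conformal]) simp_all
  also have "?l (axis 1 1) = partial_deriv 1 u p"
    by (simp only: dir_deriv_def coord_field_def)
  finally show ?thesis by (simp add: inverse_eq_divide)
qed

section \<open>Connection and curvature of a polar metric\<close>

lemma christoffel_form_polar:
  assumes s: "(s has_real_derivative s') (at (p $ 1))" "s (p $ 1) \<noteq> 0"
  shows "christoffel_form (polar_metric s) p v w
    = vector [- s (p $ 1) * s' * v $ 2 * w $ 2, s' / s (p $ 1) * (v $ 1 * w $ 2 + v $ 2 * w $ 1)]"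
proof -
  let ?b = "\<lambda>q::real^2. (s (q $ 1))\<^sup>2"
  have db: "(?b has_derivative (\<lambda>v. 2 * s (p $ 1) * s' * v $ 1)) (at p)"
    by (rule derivative_eq_intros has_derivative_radial[OF s(1)] refl)+
       (simp add: fun_eq_iff algebra_simps)
  have nz: "?b p \<noteq> 0" using s by simp
  show ?thesis
    using s(2)
    by (simp add: christoffel_form_def vec_eq_iff forall_2 sum_2 dir_deriv_eq[OF db]
          christoffel_diagonal[of "polar_metric s" "\<lambda>_. 1" ?b p, OF polar_metric_def _ nz])
       (simp add: power2_eq_square field_simps)
qed

lemma levi_civita_polar_vector:
  fixes p :: "real ^ 2"
  assumes s: "(s has_real_derivative s') (at (p $ 1))" "s (p $ 1) \<noteq> 0"
    and a: "(a has_real_derivative a') (at (p $ 1))" and b: "(b has_real_derivative b') (at (p $ 1))"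
  shows "levi_civita (polar_metric s) (\<lambda>_. v) (\<lambda>q. vector [a (q $ 1), b (q $ 1)]) p
    = vector [a' * v $ 1 - s (p $ 1) * s' * v $ 2 * b (p $ 1),
              b' * v $ 1 + s' / s (p $ 1) * (v $ 1 * b (p $ 1) + v $ 2 * a (p $ 1))]"
  by (simp add: levi_civita_def christoffel_form_polar[OF s] vec_eq_iff forall_2
     dir_deriv_eq[OF has_derivative_vector_2[OF has_derivative_radial[OF a] has_derivative_radial[OF b]]])

lemma levi_civita_cong:
  assumes "open U" "p \<in> U" "\<And>q. q \<in> U \<Longrightarrow> Y q = Z q"
  shows "levi_civita g X Y p = levi_civita g X Z p"
  using dir_deriv_cong[of U p Y Z X, OF assms(1,2)] assms(2,3) by (simp add: levi_civita_def)

lemma open_polar_patch: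
  assumes "open I" "open J"
  shows "open (polar_patch I J)"
proof -
  have "polar_patch I J = (\<lambda>x. x $ 1) -` I \<inter> (\<lambda>x. x $ 2) -` J"
    by (auto simp: polar_patch_def)
  then show ?thesis
    using assms by (simp add: open_Int open_vimage_vec_nth)
qed

text \<open>
  A surface has \<open>R(u, v) w = K (\<langle>v, w\<rangle> u - \<langle>u, w\<rangle> v)\<close> with \<open>K\<close> the Gauss curvature, here
  \<open>- s'' / s\<close>. The fields extending \<open>u\<close>, \<open>v\<close>, \<open>w\<close> have constant components, so their bracket vanishes
  and only the two iterated derivatives contribute.
\<close>

lemma curvature_at_polar:
  assumes "open L" "smooth_on s L" "\<And>t. t \<in> L \<Longrightarrow> s t \<noteq> 0" and p: "p $ 1 \<in> L"
  defines "K \<equiv> - deriv (deriv s) (p $ 1) / s (p $ 1)"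
  shows "curvature_at (polar_metric s) p u v w
    = (K * (v \<bullet> (polar_metric s p *v w))) *\<^sub>R u - (K * (u \<bullet> (polar_metric s p *v w))) *\<^sub>R v"
proof -
  let ?U = "polar_patch L UNIV"
  let ?s1 = "deriv s" and ?s2 = "deriv (deriv s)"
  have U: "open ?U" "p \<in> ?U"
    using open_polar_patch[OF \<open>open L\<close> open_UNIV] p by (auto simp: polar_patch_def)
  have s1: "(s has_real_derivative ?s1 t) (at t)" if "t \<in> L" for t
    using smooth_on_DERIV[OF assms(2) that] .
  have s2: "(?s1 has_real_derivative ?s2 t) (at t)" if "t \<in> L" for t
    using smooth_on_DERIV[OF smooth_on_deriv[OF assms(1,2)] that] .
  have inner: "levi_civita (polar_metric s) (\<lambda>_. v) (\<lambda>_. w) q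
     = vector [- s (q $ 1) * ?s1 (q $ 1) * v $ 2 * w $ 2,
               ?s1 (q $ 1) / s (q $ 1) * (v $ 1 * w $ 2 + v $ 2 * w $ 1)]" if "q \<in> ?U" for q v w
    using that assms(3)[of "q $ 1"] christoffel_form_polar[of s "?s1 (q $ 1)" q, OF s1]
    by (simp add: levi_civita_def polar_patch_def)
  have outer: "levi_civita (polar_metric s) (\<lambda>_. u) (levi_civita (polar_metric s) (\<lambda>_. v) (\<lambda>_. w)) p
     = vector [- (?s1 (p $ 1) * ?s1 (p $ 1) + s (p $ 1) * ?s2 (p $ 1)) * v $ 2 * w $ 2 * u $ 1
               - s (p $ 1) * ?s1 (p $ 1) * u $ 2 *
                  (?s1 (p $ 1) / s (p $ 1) * (v $ 1 * w $ 2 + v $ 2 * w $ 1)),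
               (?s2 (p $ 1) / s (p $ 1) - (?s1 (p $ 1) / s (p $ 1))\<^sup>2)
                  * (v $ 1 * w $ 2 + v $ 2 * w $ 1) * u $ 1
               + ?s1 (p $ 1) / s (p $ 1) *
                   (u $ 1 * (?s1 (p $ 1) / s (p $ 1) * (v $ 1 * w $ 2 + v $ 2 * w $ 1))
                    + u $ 2 * (- s (p $ 1) * ?s1 (p $ 1) * v $ 2 * w $ 2))]" for u v w
    apply (subst levi_civita_cong[OF U inner], assumption)
    apply (rule levi_civita_polar_vector[OF s1[OF p] assms(3)[OF p]])
     apply (rule derivative_eq_intros s1 s2 p refl assms(3) | simp add: algebra_simps)+
    using assms(3)[OF p] by (simp add: field_simps power2_eq_square)
  have "lie_bracket (\<lambda>_. u) (\<lambda>_. v) = (\<lambda>_. 0)"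
    by (simp add: lie_bracket_def fun_eq_iff)
  moreover have "levi_civita (polar_metric s) (\<lambda>_. 0) (\<lambda>_. w) p = 0"
    by (simp add: levi_civita_def christoffel_form_def vec_eq_iff)
  \<comment> \<open>Writing \<open>s'\<close> and \<open>s''\<close> as multiples of \<open>s\<close> removes all divisions, so the identity becomes polynomial.\<close>
  moreover obtain m n where "?s1 (p $ 1) = m * s (p $ 1)" "?s2 (p $ 1) = n * s (p $ 1)"
    using assms(3)[OF p]
    by (intro that[of "?s1 (p $ 1) / s (p $ 1)" "?s2 (p $ 1) / s (p $ 1)"]) simp_all
  ultimately show ?thesis
    using assms(3)[OF p]
    by (simp add: curvature_at_def curvature_def outer K_def vec_eq_iff forall_2 inner_vec_def sum_2
         matrix_vector_mult_def polar_metric_def)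
       (simp add: algebra_simps power2_eq_square)
qed

section \<open>The pullback connection of a rotationally symmetric map\<close>

lemma laplacian_cong:
  assumes "open U" "p \<in> U" "\<And>q. q \<in> U \<Longrightarrow> u q = v q"
  shows "laplacian g u p = laplacian g v p"
proof -
  have eq: "dir_deriv X u q = dir_deriv X v q" if "q \<in> U" for X q
    by (rule dir_deriv_cong[OF assms(1) that assms(3)])
  have "dir_deriv X (dir_deriv Y u) p = dir_deriv X (dir_deriv Y v) p" for X Y
    by (rule dir_deriv_cong[OF assms(1,2) eq])
  then show ?thesis
    by (simp only: laplacian_def eq[OF assms(2)])
qed

lemma pullback_conn_cong:
  assumes "open U" "p \<in> U" "\<And>q. q \<in> U \<Longrightarrow> V q = W q"
  shows "pullback_conn h \<phi> X V p = pullback_conn h \<phi> X W p"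
  using dir_deriv_cong[where U = U and p = p and u = V and v = W and X = X] assms
  by (simp add: pullback_conn_def)

lemma pullback_conn_at_point:
  "pullback_conn h \<phi> X V p = pullback_conn h \<phi> (\<lambda>_. X p) V p"
  by (simp add: pullback_conn_def dir_deriv_def)

lemma linear_christoffel_form: "linear (\<lambda>v. christoffel_form g p v w)"
  by (rule linearI)
     (simp_all add: christoffel_form_def vec_eq_iff sum.distrib sum_distrib_left algebra_simps)

lemma linear_pullback_conn:
  assumes "V differentiable (at p)" "\<phi> differentiable (at p)"
  shows "linear (\<lambda>v. pullback_conn h \<phi> (\<lambda>_. v) V p)"
proof -
  have "linear (\<lambda>v. christoffel_form h (\<phi> p) (frechet_derivative \<phi> (at p) v) (V p))"
    using linear_compose[OF linear_frechet_derivative[OF assms(2)] linear_christoffel_form]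
    by (simp add: o_def)
  then show ?thesis
    unfolding pullback_conn_def dir_deriv_def
    by (rule linear_compose_add[OF linear_frechet_derivative[OF assms(1)]])
qed

lemma has_derivative_rot_sym_map:
  assumes "(\<rho> has_real_derivative \<rho>') (at (p $ 1))"
  shows "(rot_sym_map \<rho> k has_derivative (\<lambda>v. vector [\<rho>' * v $ 1, k * v $ 2])) (at p)"
  unfolding rot_sym_map_def[abs_def]
  by (intro has_derivative_vector_2 has_derivative_radial assms has_derivative_mult_right
      bounded_linear.has_derivative[OF bounded_linear_vec_nth]) simp

text \<open>
  The coefficients of the connection along the map depend only on \<open>r\<close>. The angular derivative turns
  the radial component \<open>a\<close> into the angular component \<open>k l' a / l\<close> and, applied once more, returns
  \<open>- k\<^sup>2 l'\<^sup>2 a\<close> to the radial one. These two terms are the source of the second equation of the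
  system and of one of the two terms of \<open>(l l')'\<close> in the first.
\<close>

lemma pullback_conn_rot_sym_map:
  assumes \<rho>: "(\<rho> has_real_derivative \<rho>') (at (p $ 1))"
    and l: "(l has_real_derivative l') (at (\<rho> (p $ 1)))" "l (\<rho> (p $ 1)) \<noteq> 0"
    and a: "(a has_derivative a') (at p)" and b: "(b has_derivative b') (at p)"
  shows "pullback_conn (polar_metric l) (rot_sym_map \<rho> k) X (\<lambda>q. vector [a q, b q]) p
     = vector [a' (X p) - l (\<rho> (p $ 1)) * l' * (k * X p $ 2) * b p,
               b' (X p) + l' / l (\<rho> (p $ 1)) * (\<rho>' * X p $ 1 * b p + k * X p $ 2 * a p)]"
proof -
  have r: "rot_sym_map \<rho> k p $ 1 = \<rho> (p $ 1)" by (simp add: rot_sym_map_def)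
  have "christoffel_form (polar_metric l) (rot_sym_map \<rho> k p) v w
      = vector [- l (\<rho> (p $ 1)) * l' * v $ 2 * w $ 2,
          l' / l (\<rho> (p $ 1)) * (v $ 1 * w $ 2 + v $ 2 * w $ 1)]" for v w
    by (rule christoffel_form_polar[of l l' "rot_sym_map \<rho> k p", unfolded r, OF l])
  then show ?thesis
    by (simp add: pullback_conn_def dir_deriv_eq[OF has_derivative_vector_2[OF a b]]
      dir_deriv_eq[OF has_derivative_rot_sym_map[OF \<rho>]] vec_eq_iff forall_2)
qed

lemma laplacian_polar_radial:
  assumes "open I" and p: "p $ 1 \<in> I"
    and s: "(s has_real_derivative s') (at (p $ 1))" "s (p $ 1) \<noteq> 0"
    and w: "\<And>r. r \<in> I \<Longrightarrow> (w has_real_derivative deriv w r) (at r)"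
    and w2: "(deriv w has_real_derivative w'') (at (p $ 1))"
  shows "laplacian (polar_metric s) (\<lambda>q. w (q $ 1)) p = w'' + s' / s (p $ 1) * deriv w (p $ 1)"
proof -
  let ?U = "polar_patch I UNIV" and ?u = "\<lambda>q::real^2. w (q $ 1)"
  have U: "open ?U" "p \<in> ?U" using open_polar_patch[OF assms(1) open_UNIV] p by (auto simp: polar_patch_def)
  have d: "dir_deriv (coord_field i) ?u q = deriv w (q $ 1) * coord_field i q $ 1" if "q \<in> ?U" for i q
    using dir_deriv_eq[OF has_derivative_radial[OF w]] that by (simp add: polar_patch_def)
  have "partial_deriv 1 (partial_deriv 1 ?u) p = partial_deriv 1 (\<lambda>q. deriv w (q $ 1)) p"
    by (rule dir_deriv_cong[OF U]) (simp add: d)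
  moreover have "partial_deriv 2 (partial_deriv 2 ?u) p = partial_deriv 2 (\<lambda>q. 0::real) p"
    by (rule dir_deriv_cong[OF U]) (simp add: d)
  moreover have "?u differentiable (at p)"
    using has_derivative_radial[OF w[OF p]] by (rule differentiableI)
  ultimately show ?thesis
    using d[OF U(2)] by (simp add: laplacian_polar[OF _ s] dir_deriv_eq[OF has_derivative_radial[OF w2]])
qed

text \<open>
  Restriction to a radial line turns the partial derivatives of a function on the patch into ordinary
  derivatives. In this way the radial profile of a function inherits the regularity of the function.
\<close>

lemma DERIV_slice:
  fixes u :: "real ^ 2 \<Rightarrow> real"
  assumes "u differentiable (at (vector [r, \<theta>]))"
  shows "((\<lambda>t. u (vector [t, \<theta>])) has_real_derivative partial_deriv 1 u (vector [r, \<theta>])) (at r)"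
proof -
  let ?p = "vector [r, \<theta>] :: real ^ 2"
  have 1: "((\<lambda>t. vector [t, \<theta>] :: real ^ 2) has_derivative (\<lambda>h. vector [h, 0])) (at r)"
    by (intro has_derivative_vector_2 derivative_intros)
  have 2: "(u has_derivative frechet_derivative u (at ?p)) (at ?p)"
    using assms by (simp add: frechet_derivative_works)
  have "vector [h, 0] = h *\<^sub>R (axis 1 1 :: real ^ 2)" for h :: real
    by (simp add: vec_eq_iff forall_2 axis_def)
  then have "frechet_derivative u (at ?p) (vector [h, 0]) = h * partial_deriv 1 u ?p" for h
    using linear_scale[OF linear_frechet_derivative[OF assms]]
    by (simp add: dir_deriv_def coord_field_def)
  with has_derivative_compose[OF 1 2] show ?thesis
    by (simp add: has_field_derivative_def mult.commute[of _ "partial_deriv 1 u ?p"])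
qed

section \<open>Tension and bitension of a conformally changed domain\<close>

locale rotationally_symmetric_map =
  fixes k :: real and \<sigma> lam \<rho> :: "real \<Rightarrow> real" and f :: "real ^ 2 \<Rightarrow> real" and I J L :: "real set"
  assumes open_I: "open I" and open_J: "open J" and open_L: "open L"
    and \<sigma>: "smooth_on \<sigma> I" "\<And>r. r \<in> I \<Longrightarrow> \<sigma> r > 0"
    and lam: "smooth_on lam L" "\<And>t. t \<in> L \<Longrightarrow> lam t > 0"
    and \<rho>: "smooth_on \<rho> I" "\<And>r. r \<in> I \<Longrightarrow> \<rho> r \<in> L"
    and f: "smooth_on f (polar_patch I J)" "\<And>p. p \<in> polar_patch I J \<Longrightarrow> f p > 0"
begin

abbreviation "U \<equiv> polar_patch I J"

abbreviation "gbar \<equiv> conformal_metric (\<lambda>p. inverse (f p)) (polar_metric \<sigma>)"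

text \<open>
  The radial component of the tension field with respect to the unscaled metric; it is the function
  \<open>x\<close> of the theorem.
\<close>

definition radial_tension :: "real \<Rightarrow> real" where
  "radial_tension r = deriv (deriv \<rho>) r + deriv \<sigma> r / \<sigma> r * deriv \<rho> r
     - k\<^sup>2 * lam (\<rho> r) * deriv lam (\<rho> r) / (\<sigma> r)\<^sup>2"

text \<open>
  The product \<open>x f\<close>, the radial component of the tension field with respect to the metric
  \<open>g / f\<close>.
\<close>

definition scaled_tension :: "real ^ 2 \<Rightarrow> real" where
  "scaled_tension p = radial_tension (p $ 1) * f p"

lemma open_U: "open U"
  using open_polar_patch open_I open_J .

lemma U_I: "p \<in> U \<Longrightarrow> p $ 1 \<in> I"
  by (simp add: polar_patch_def)

lemmas D\<sigma> = smooth_on_DERIV[OF \<sigma>(1)]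
lemmas D\<rho> = smooth_on_DERIV[OF \<rho>(1)]
lemmas Dlam = smooth_on_DERIV[OF lam(1) \<rho>(2)]
lemmas D2\<sigma> = smooth_on_DERIV[OF smooth_on_deriv[OF open_I \<sigma>(1)]]
lemmas D2\<rho> = smooth_on_DERIV[OF smooth_on_deriv[OF open_I \<rho>(1)]]
lemmas D2lam = smooth_on_DERIV[OF smooth_on_deriv[OF open_L lam(1)] \<rho>(2)]

lemma nonzero [simp]: "r \<in> I \<Longrightarrow> \<sigma> r \<noteq> 0" "r \<in> I \<Longrightarrow> lam (\<rho> r) \<noteq> 0" "p \<in> U \<Longrightarrow> f p \<noteq> 0"
  using \<sigma>(2) lam(2) \<rho>(2) f(2) by force+

text \<open>
  By conformal invariance the factor \<open>f\<close> comes out. The angular component vanishes because \<open>k \<theta>\<close> is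
  harmonic for the polar metric and the mixed symbol of the target is multiplied by the inner product
  of the gradients of \<open>\<rho>\<close> and \<open>k \<theta>\<close>, which are orthogonal.
\<close>

lemma tension_conformal:
  assumes p: "p \<in> U"
  shows "tension gbar (polar_metric lam) (rot_sym_map \<rho> k) p = vector [scaled_tension p, 0]"
proof -
  let ?h = "polar_metric lam" and ?\<phi> = "rot_sym_map \<rho> k"
  note I = U_I[OF p]
  note conn = pullback_conn_rot_sym_map[OF D\<rho>[OF I] Dlam[OF I] nonzero(2)[OF I]]
  have d\<phi>: "dir_deriv X ?\<phi> q = vector [deriv \<rho> (q $ 1) * X q $ 1, k * X q $ 2]" if "q \<in> U" for X q
    using dir_deriv_eq[OF has_derivative_rot_sym_map[OF D\<rho>[OF U_I[OF that]]]] .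
  have c1: "pullback_conn ?h ?\<phi> (coord_field 1) (partial_deriv 1 ?\<phi>) p
      = pullback_conn ?h ?\<phi> (coord_field 1) (\<lambda>q. vector [deriv \<rho> (q $ 1), 0]) p"
    by (rule pullback_conn_cong[OF open_U p]) (simp add: d\<phi>)
  have c2: "pullback_conn ?h ?\<phi> (coord_field 2) (partial_deriv 2 ?\<phi>) p
      = pullback_conn ?h ?\<phi> (coord_field 2) (\<lambda>q. vector [0, k]) p"
    by (rule pullback_conn_cong[OF open_U p]) (simp add: d\<phi>)
  have "?\<phi> differentiable (at p)"
    using has_derivative_rot_sym_map[OF D\<rho>[OF I]] by (rule differentiableI)
  moreover have "(\<lambda>q. inverse (f q)) differentiable (at p)"
    using smooth_on_differentiable[OF f(1) p] p by (intro differentiable_inverse) auto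
  ultimately have "tension gbar ?h ?\<phi> p = inverse (inverse (f p)) *\<^sub>R
     (pullback_conn ?h ?\<phi> (coord_field 1) (partial_deriv 1 ?\<phi>) p
      + inverse ((\<sigma> (p $ 1))\<^sup>2) *\<^sub>R pullback_conn ?h ?\<phi> (coord_field 2) (partial_deriv 2 ?\<phi>) p
      + (deriv \<sigma> (p $ 1) / \<sigma> (p $ 1)) *\<^sub>R frechet_derivative ?\<phi> (at p) (axis 1 1))"
    unfolding tension_def second_fundamental_form_def dir_deriv_def[of "levi_civita _ _ _"]
    using p I by (intro metric_trace_minus_connection linear_frechet_derivative D\<sigma>) auto
  also have "frechet_derivative ?\<phi> (at p) (axis 1 1) = vector [deriv \<rho> (p $ 1), 0]"
    using d\<phi>[OF p, of "coord_field 1"] unfolding dir_deriv_def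
    by (simp add: coord_field_def axis_def)
  finally show ?thesis
    unfolding c1 c2 conn[OF has_derivative_radial[OF D2\<rho>[OF I]] has_derivative_const]
      conn[OF has_derivative_const has_derivative_const]
    using I p
    by (simp add: vec_eq_iff forall_2 scaled_tension_def radial_tension_def divide_inverse
        power2_eq_square algebra_simps)
qed

text \<open>
  The bitension field differentiates the tension field twice, so \<open>x\<close> must be twice differentiable;
  this consumes four derivatives of \<open>\<rho>\<close> and three of \<open>\<sigma>\<close> and \<open>lam\<close>.
\<close>

lemma radial_tension_C2:
  "\<exists>D. \<forall>r\<in>I. (radial_tension has_real_derivative D r) (at r) \<and> D differentiable (at r)"
proof -
  have D3\<rho>: "(deriv (deriv \<rho>) has_real_derivative deriv (deriv (deriv \<rho>)) r) (at r)"
    "(deriv (deriv (deriv \<rho>)) has_real_derivative deriv (deriv (deriv (deriv \<rho>))) r) (at r)"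
    if "r \<in> I" for r
    by (rule smooth_on_DERIV[OF _ that] smooth_on_deriv[OF open_I] \<rho>(1))+
  have D3\<sigma>: "(deriv (deriv \<sigma>) has_real_derivative deriv (deriv (deriv \<sigma>)) r) (at r)"
    if "r \<in> I" for r
    by (rule smooth_on_DERIV[OF _ that] smooth_on_deriv[OF open_I] \<sigma>(1))+
  have D3lam: "(deriv (deriv lam) has_real_derivative deriv (deriv (deriv lam)) (\<rho> r)) (at (\<rho> r))"
    if "r \<in> I" for r
    by (rule smooth_on_DERIV[OF _ \<rho>(2)[OF that]] smooth_on_deriv[OF open_L] lam(1))+
  note chain = DERIV_chain2[OF Dlam D\<rho>] DERIV_chain2[OF D2lam D\<rho>] DERIV_chain2[OF D3lam D\<rho>]
  define D where "D = (\<lambda>r. deriv (deriv (deriv \<rho>)) r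
     + ((deriv (deriv \<sigma>) r * \<sigma> r - deriv \<sigma> r * deriv \<sigma> r) / (\<sigma> r * \<sigma> r)) * deriv \<rho> r
     + deriv \<sigma> r / \<sigma> r * deriv (deriv \<rho>) r
     - k\<^sup>2 * (((deriv lam (\<rho> r) * deriv \<rho> r) * deriv lam (\<rho> r)
                + lam (\<rho> r) * (deriv (deriv lam) (\<rho> r) * deriv \<rho> r)) * \<sigma> r
              - 2 * lam (\<rho> r) * deriv lam (\<rho> r) * deriv \<sigma> r) / (\<sigma> r * (\<sigma> r * \<sigma> r)))"
  show ?thesis
  proof (intro exI[of _ D] ballI conjI)
    fix r assume r: "r \<in> I"
    show "(radial_tension has_real_derivative D r) (at r)"
      unfolding radial_tension_def[abs_def]
      apply (rule derivative_eq_intros D\<sigma> D\<rho> D2\<sigma> D2\<rho> D3\<rho> chain r refl | simp add: r)+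
      using nonzero(1)[OF r] by (simp add: D_def field_simps power2_eq_square power4_eq_xxxx)
    have diff: "g differentiable (at r)" if "(g has_real_derivative g') (at r)" for g g'
      using that real_differentiable_def by blast
    show "D differentiable (at r)"
      unfolding D_def
      by (intro differentiable_add differentiable_diff differentiable_mult differentiable_divide
          differentiable_const diff[OF D\<sigma>[OF r]] diff[OF D\<rho>[OF r]] diff[OF D2\<sigma>[OF r]]
          diff[OF D2\<rho>[OF r]] diff[OF D3\<rho>(1)[OF r]] diff[OF D3\<rho>(2)[OF r]] diff[OF D3\<sigma>[OF r]]
          diff[OF chain(1)[OF r r]] diff[OF chain(2)[OF r r]] diff[OF chain(3)[OF r r]])
        (use r in auto)
  qed
qed

lemma scaled_tension_C2:
  assumes p: "p \<in> U"
  shows "scaled_tension differentiable (at p)" "partial_deriv i scaled_tension differentiable (at p)"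
    "partial_deriv 2 scaled_tension p = radial_tension (p $ 1) * partial_deriv 2 f p"
proof -
  obtain D where D: "\<And>r. r \<in> I \<Longrightarrow> (radial_tension has_real_derivative D r) (at r)"
    "\<And>r. r \<in> I \<Longrightarrow> D differentiable (at r)" using radial_tension_C2 by blast
  have d: "(scaled_tension has_derivative (\<lambda>v. radial_tension (q $ 1) * frechet_derivative f (at q) v
         + D (q $ 1) * v $ 1 * f q)) (at q)" if "q \<in> U" for q
    unfolding scaled_tension_def[abs_def]
    using smooth_on_differentiable[OF f(1) that]
    by (intro has_derivative_mult has_derivative_radial D U_I that) (simp add: frechet_derivative_works)
  show "scaled_tension differentiable (at p)" using d[OF p] by (rule differentiableI)
  have eq: "partial_deriv i scaled_tension q = radial_tension (q $ 1) * partial_deriv i f q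
         + D (q $ 1) * coord_field i q $ 1 * f q" if "q \<in> U" for q i
    using dir_deriv_eq[OF d[OF that], of "coord_field i"] by (simp add: dir_deriv_def)
  show "partial_deriv 2 scaled_tension p = radial_tension (p $ 1) * partial_deriv 2 f p"
    using eq[OF p] by simp
  have "partial_deriv i f differentiable (at p)"
    using smooth_on_differentiable[OF smooth_on_dir_deriv_const[OF f(1)] p]
    by (simp add: coord_field_def)
  moreover have "(\<lambda>q. radial_tension (q $ 1)) differentiable (at p)"
    using has_derivative_radial[OF D(1)[OF U_I[OF p]]] by (rule differentiableI)
  moreover obtain D' where "(D has_real_derivative D') (at (p $ 1))"
    using D(2)[OF U_I[OF p]] real_differentiable_def by blast
  then have "(\<lambda>q. D (q $ 1)) differentiable (at p)"
    by (rule differentiableI[OF has_derivative_radial])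
  ultimately have "(\<lambda>q. radial_tension (q $ 1) * partial_deriv i f q
         + D (q $ 1) * (if 1 = i then 1 else 0) * f q) differentiable (at p)"
    using smooth_on_differentiable[OF f(1) p]
    by (intro differentiable_add differentiable_mult differentiable_const)
  then obtain E where "((\<lambda>q. radial_tension (q $ 1) * partial_deriv i f q
         + D (q $ 1) * (if 1 = i then 1 else 0) * f q) has_derivative E) (at p)"
    unfolding differentiable_def by blast
  then have "(partial_deriv i scaled_tension has_derivative E) (at p)"
    by (rule has_derivative_transform_within_open[OF _ open_U p]) (simp add: eq)
  then show "partial_deriv i scaled_tension differentiable (at p)" by (rule differentiableI)
qed

text \<open>
  With \<open>V = (y, 0)\<close> the tension field, the second covariant derivatives of \<open>V\<close> give \<open>\<Delta>y\<close>, the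
  zeroth order term \<open>- k\<^sup>2 lam'\<^sup>2 y / \<sigma>\<^sup>2\<close> and, in the angular component, twice the term
  \<open>k lam' y\<^sub>\<theta> / (\<sigma>\<^sup>2 lam)\<close>: once from differentiating the angular part of the first derivative and once
  from rotating \<open>y\<^sub>\<theta>\<close>. The curvature is only seen by the angular direction, since \<open>V\<close> is parallel to
  the radial derivative of the map, and contributes \<open>- k\<^sup>2 lam lam'' y / \<sigma>\<^sup>2\<close>. The two zeroth order
  terms add up to \<open>(lam lam')'\<close>.
\<close>

lemma bitension_conformal:
  assumes p: "p \<in> U"
  shows "bitension gbar (polar_metric lam) (rot_sym_map \<rho> k) p
    = f p *\<^sub>R vector
       [laplacian (polar_metric \<sigma>) scaled_tension p
          - k\<^sup>2 * deriv (\<lambda>t. lam t * deriv lam t) (\<rho> (p $ 1)) / (\<sigma> (p $ 1))\<^sup>2 * scaled_tension p,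
        2 * (k * partial_deriv 2 f p * deriv lam (\<rho> (p $ 1)) * radial_tension (p $ 1)
               / ((\<sigma> (p $ 1))\<^sup>2 * lam (\<rho> (p $ 1))))]"
proof -
  let ?h = "polar_metric lam" and ?\<phi> = "rot_sym_map \<rho> k"
  let ?y = scaled_tension and ?V = "\<lambda>q. vector [scaled_tension q, 0] :: real ^ 2"
  let ?m = "\<lambda>r. deriv lam (\<rho> r) / lam (\<rho> r)"
  let ?\<tau> = "tension gbar ?h ?\<phi>"
  note I = U_I[OF p]
  note conn = pullback_conn_rot_sym_map[OF D\<rho> Dlam nonzero(2)]
  have dy: "(?y has_derivative frechet_derivative ?y (at q)) (at q)" if "q \<in> U" for q
    using scaled_tension_C2(1)[OF that] by (simp add: frechet_derivative_works)
  have ddy: "(partial_deriv i ?y has_derivative frechet_derivative (partial_deriv i ?y) (at p)) (at p)" for i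
    using scaled_tension_C2(2)[OF p] by (simp add: frechet_derivative_works)
  have \<tau>: "pullback_conn ?h ?\<phi> X ?\<tau> q = pullback_conn ?h ?\<phi> X ?V q" if "q \<in> U" for q X
    by (rule pullback_conn_cong[OF open_U that tension_conformal])
  have first: "pullback_conn ?h ?\<phi> (coord_field i) ?\<tau> q
     = vector [partial_deriv i ?y q, ?m (q $ 1) * (k * coord_field i q $ 2 * ?y q)]" if "q \<in> U" for i q
    unfolding \<tau>[OF that] using that conn[OF U_I U_I U_I dy has_derivative_const]
    by (simp add: dir_deriv_def)
  obtain m' where m': "(?m has_real_derivative m') (at (p $ 1))"
    using DERIV_divide[OF DERIV_chain2[OF D2lam D\<rho>] DERIV_chain2[OF Dlam D\<rho>]] I by force
  have c1: "pullback_conn ?h ?\<phi> (coord_field 1) (pullback_conn ?h ?\<phi> (coord_field 1) ?\<tau>) p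
      = pullback_conn ?h ?\<phi> (coord_field 1) (\<lambda>q. vector [partial_deriv 1 ?y q, 0]) p"
    by (rule pullback_conn_cong[OF open_U p]) (simp add: first)
  have c2: "pullback_conn ?h ?\<phi> (coord_field 2) (pullback_conn ?h ?\<phi> (coord_field 2) ?\<tau>) p
      = pullback_conn ?h ?\<phi> (coord_field 2)
          (\<lambda>q. vector [partial_deriv 2 ?y q, ?m (q $ 1) * (k * ?y q)]) p"
    by (rule pullback_conn_cong[OF open_U p]) (simp add: first)
  have dm: "((\<lambda>q. ?m (q $ 1) * (k * ?y q)) has_derivative
       (\<lambda>v. ?m (p $ 1) * (k * frechet_derivative ?y (at p) v) + m' * v $ 1 * (k * ?y p))) (at p)"
    by (intro has_derivative_mult has_derivative_radial[OF m'] has_derivative_mult_right dy p)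
  have fy: "frechet_derivative ?y (at p) (coord_field i p) = partial_deriv i ?y p" for i
    by (simp add: dir_deriv_def)
  have fyy: "frechet_derivative (partial_deriv j ?y) (at p) (coord_field i p)
     = partial_deriv i (partial_deriv j ?y) p" for i j
    by (simp add: dir_deriv_def)
  have d\<phi>: "dir_deriv X ?\<phi> p = vector [deriv \<rho> (p $ 1) * X p $ 1, k * X p $ 2]" for X
    using dir_deriv_eq[OF has_derivative_rot_sym_map[OF D\<rho>[OF I]]] .
  have lin: "linear (\<lambda>v. pullback_conn ?h ?\<phi> (\<lambda>_. v) ?V p)"
    by (rule linear_pullback_conn[OF
          differentiableI[OF has_derivative_vector_2[OF dy[OF p] has_derivative_const]]
          differentiableI[OF has_derivative_rot_sym_map[OF D\<rho>[OF I]]]])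
  have "(\<lambda>q. inverse (f q)) differentiable (at p)"
    using smooth_on_differentiable[OF f(1) p] p by (intro differentiable_inverse) auto
  then have "metric_trace gbar p
       (\<lambda>i j. pullback_conn ?h ?\<phi> (coord_field i) (pullback_conn ?h ?\<phi> (coord_field j) ?\<tau>) p
            - pullback_conn ?h ?\<phi> (levi_civita gbar (coord_field i) (coord_field j)) ?\<tau> p)
    = inverse (inverse (f p)) *\<^sub>R
        (pullback_conn ?h ?\<phi> (coord_field 1) (pullback_conn ?h ?\<phi> (coord_field 1) ?\<tau>) p
         + inverse ((\<sigma> (p $ 1))\<^sup>2) *\<^sub>R
            pullback_conn ?h ?\<phi> (coord_field 2) (pullback_conn ?h ?\<phi> (coord_field 2) ?\<tau>) p
         + (deriv \<sigma> (p $ 1) / \<sigma> (p $ 1)) *\<^sub>R pullback_conn ?h ?\<phi> (\<lambda>_. axis 1 1) ?V p)"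
    unfolding \<tau>[OF p, of "levi_civita _ _ _"] unfolding
      pullback_conn_at_point[of _ _ "levi_civita _ _ _"]
    using p I by (intro metric_trace_minus_connection lin D\<sigma>) auto
  also have "pullback_conn ?h ?\<phi> (\<lambda>_. axis 1 1) ?V p = vector [partial_deriv 1 ?y p, 0]"
    using first[OF p, of 1] unfolding \<tau>[OF p] by (simp add: coord_field_def axis_def)
  finally have trace: "metric_trace gbar p
       (\<lambda>i j. pullback_conn ?h ?\<phi> (coord_field i) (pullback_conn ?h ?\<phi> (coord_field j) ?\<tau>) p
            - pullback_conn ?h ?\<phi> (levi_civita gbar (coord_field i) (coord_field j)) ?\<tau> p)
    = f p *\<^sub>R vector [laplacian (polar_metric \<sigma>) ?y p
           - k\<^sup>2 * (deriv lam (\<rho> (p $ 1)))\<^sup>2 / (\<sigma> (p $ 1))\<^sup>2 * ?y p,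
        2 * (k * partial_deriv 2 f p * deriv lam (\<rho> (p $ 1)) * radial_tension (p $ 1)
               / ((\<sigma> (p $ 1))\<^sup>2 * lam (\<rho> (p $ 1))))]"
    unfolding c1 c2 conn[OF I I I ddy has_derivative_const] conn[OF I I I ddy dm] fy fyy
      laplacian_polar[OF scaled_tension_C2(1)[OF p] D\<sigma>[OF I] nonzero(1)[OF I]]
    using I p by (simp add: vec_eq_iff forall_2 scaled_tension_C2(3)[OF p])
      (simp add: field_simps power2_eq_square)
  have r: "?\<phi> p $ 1 = \<rho> (p $ 1)" by (simp add: rot_sym_map_def)
  have curv: "curvature_at ?h (?\<phi> p) u v w
      = (- deriv (deriv lam) (\<rho> (p $ 1)) / lam (\<rho> (p $ 1)) * (v \<bullet> (?h (?\<phi> p) *v w))) *\<^sub>R u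
        - (- deriv (deriv lam) (\<rho> (p $ 1)) / lam (\<rho> (p $ 1)) * (u \<bullet> (?h (?\<phi> p) *v w))) *\<^sub>R v"
    for u v w
    unfolding r[symmetric] using lam(2) \<rho>(2)[OF I] r
    by (intro curvature_at_polar[OF open_L lam(1)]) force+
  \<comment> \<open>For \<open>i = j = 1\<close> the first two arguments of the curvature are parallel, so that term is zero.\<close>
  have "metric_trace gbar p
       (\<lambda>i j. curvature_at ?h (?\<phi> p) (partial_deriv i ?\<phi> p) (?\<tau> p) (partial_deriv j ?\<phi> p))
    = f p *\<^sub>R vector [k\<^sup>2 * (lam (\<rho> (p $ 1)) * deriv (deriv lam) (\<rho> (p $ 1))) / (\<sigma> (p $ 1))\<^sup>2 * ?y p, 0]"
    unfolding tension_conformal[OF p] using I p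
    by (subst metric_trace_diagonal[of gbar p "inverse (f p)" "inverse (f p) * (\<sigma> (p $ 1))\<^sup>2"])
       (simp_all add: conformal_polar_metric_eq curv d\<phi> vec_eq_iff forall_2
         inner_vec_def sum_2 matrix_vector_mult_def polar_metric_def r field_simps power2_eq_square)
  moreover have "deriv (\<lambda>t. lam t * deriv lam t) (\<rho> (p $ 1))
      = (deriv lam (\<rho> (p $ 1)))\<^sup>2 + lam (\<rho> (p $ 1)) * deriv (deriv lam) (\<rho> (p $ 1))"
    using DERIV_imp_deriv[OF DERIV_mult[OF Dlam[OF I] D2lam[OF I]]]
    by (simp add: power2_eq_square algebra_simps)
  ultimately show ?thesis
    unfolding bitension_def trace
    by (simp add: vec_eq_iff forall_2 algebra_simps add_divide_distrib)
qed

section \<open>The two systems\<close>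

lemma biharmonic_iff:
  "biharmonic_on U gbar (polar_metric lam) (rot_sym_map \<rho> k) \<longleftrightarrow>
    (\<forall>p\<in>U. laplacian (polar_metric \<sigma>) scaled_tension p =
        k\<^sup>2 * deriv (\<lambda>t. lam t * deriv lam t) (\<rho> (p $ 1)) / (\<sigma> (p $ 1))\<^sup>2 * scaled_tension p \<and>
      k * partial_deriv 2 f p * deriv lam (\<rho> (p $ 1)) * radial_tension (p $ 1)
               / ((\<sigma> (p $ 1))\<^sup>2 * lam (\<rho> (p $ 1))) = 0)"
  unfolding biharmonic_on_def
proof (rule ball_cong[OF refl])
  fix p assume p: "p \<in> U"
  have *: "c *\<^sub>R (vector [a, 2 * b] :: real ^ 2) = 0 \<longleftrightarrow> a = 0 \<and> b = 0" if "c \<noteq> 0" for a b c :: real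
    using that by (auto simp: vec_eq_iff forall_2)
  show "bitension gbar (polar_metric lam) (rot_sym_map \<rho> k) p = 0 \<longleftrightarrow>
    laplacian (polar_metric \<sigma>) scaled_tension p =
        k\<^sup>2 * deriv (\<lambda>t. lam t * deriv lam t) (\<rho> (p $ 1)) / (\<sigma> (p $ 1))\<^sup>2 * scaled_tension p \<and>
      k * partial_deriv 2 f p * deriv lam (\<rho> (p $ 1)) * radial_tension (p $ 1)
               / ((\<sigma> (p $ 1))\<^sup>2 * lam (\<rho> (p $ 1))) = 0"
    unfolding bitension_conformal[OF p] *[OF nonzero(3)[OF p]] right_minus_eq ..
qed

lemma laplacian_radius_eq_radial_tension:
  assumes "p \<in> U"
  shows "laplacian (polar_metric \<sigma>) (\<lambda>q. \<rho> (q $ 1)) p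
    - k\<^sup>2 * lam (\<rho> (p $ 1)) * deriv lam (\<rho> (p $ 1)) / (\<sigma> (p $ 1))\<^sup>2 = radial_tension (p $ 1)"
  using laplacian_polar_radial[OF open_I U_I[OF assms] D\<sigma>[OF U_I[OF assms]] nonzero(1)[OF U_I[OF assms]]
       D\<rho> D2\<rho>[OF U_I[OF assms]]]
  by (simp add: radial_tension_def)

text \<open>
  On \<open>I\<close> the function \<open>Y\<close> is the restriction of the scaled tension to the radial line through \<open>p\<close>,
  which makes it twice differentiable and turns the radial partial derivatives into ordinary ones.
\<close>

lemma laplacian_scaled_tension_radial:
  assumes F: "\<And>p. p \<in> U \<Longrightarrow> f p = F (p $ 1)" and p: "p \<in> U"
  defines "Y \<equiv> \<lambda>r. F r * radial_tension r"
  shows "laplacian (polar_metric \<sigma>) scaled_tension p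
     = deriv (deriv Y) (p $ 1) + deriv \<sigma> (p $ 1) / \<sigma> (p $ 1) * deriv Y (p $ 1)"
proof -
  let ?y = scaled_tension
  let ?at = "\<lambda>r. vector [r, p $ 2] :: real ^ 2"
  note I = U_I[OF p]
  have atU: "?at r \<in> U" if "r \<in> I" for r
    using that p by (simp add: polar_patch_def)
  have y: "?y q = Y (q $ 1)" if "q \<in> U" for q
    using F[OF that] by (simp add: scaled_tension_def Y_def)
  have DY: "(Y has_real_derivative partial_deriv 1 ?y (?at r)) (at r)" if r: "r \<in> I" for r
  proof -
    have "((\<lambda>t. ?y (?at t)) has_real_derivative partial_deriv 1 ?y (?at r)) (at r)"
      by (rule DERIV_slice[OF scaled_tension_C2(1)[OF atU[OF r]]])
    then show ?thesis
      using has_field_derivative_transform_within_open[OF _ open_I r, of "\<lambda>t. ?y (?at t)" _ Y] y[OF atU]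
      by simp
  qed
  have dY: "deriv Y r = partial_deriv 1 ?y (?at r)" if "r \<in> I" for r
    using DERIV_imp_deriv[OF DY[OF that]] .
  have e: "(deriv Y has_real_derivative partial_deriv 1 (partial_deriv 1 ?y) (?at (p $ 1))) (at (p $ 1))"
    using has_field_derivative_transform_within_open[OF
        DERIV_slice[OF scaled_tension_C2(2)[OF atU[OF I]]] open_I I] dY by simp
  have D2Y: "(deriv Y has_real_derivative deriv (deriv Y) (p $ 1)) (at (p $ 1))"
    unfolding DERIV_imp_deriv[OF e] by (rule e)
  have "laplacian (polar_metric \<sigma>) ?y p = laplacian (polar_metric \<sigma>) (\<lambda>q. Y (q $ 1)) p"
    by (rule laplacian_cong[OF open_U p y])
  also have "\<dots> = deriv (deriv Y) (p $ 1) + deriv \<sigma> (p $ 1) / \<sigma> (p $ 1) * deriv Y (p $ 1)"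
    using DY dY by (intro laplacian_polar_radial[OF open_I I D\<sigma>[OF I] nonzero(1)[OF I] _ D2Y]) simp
  finally show ?thesis .
qed

lemma partial_deriv_2_radial:
  assumes F: "\<And>p. p \<in> U \<Longrightarrow> f p = F (p $ 1)" and p: "p \<in> U"
  shows "partial_deriv 2 f p = 0"
proof -
  \<comment> \<open>Near \<open>p\<close> the function \<open>f\<close> equals its restriction to one radial line, composed with the radial coordinate.\<close>
  let ?w = "\<lambda>r. f (vector [r, p $ 2])"
  have "(vector [p $ 1, p $ 2] :: real ^ 2) = p" by (simp add: vec_eq_iff forall_2)
  then have "f differentiable (at (vector [p $ 1, p $ 2]))"
    using smooth_on_differentiable[OF f(1) p] by simp
  note slice = has_derivative_radial[OF DERIV_slice[OF this]]
  have "partial_deriv 2 f p = partial_deriv 2 (\<lambda>q. ?w (q $ 1)) p"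
    using p by (intro dir_deriv_cong[OF open_U p]) (simp add: F polar_patch_def)
  also have "\<dots> = 0"
    by (simp add: dir_deriv_eq[OF slice])
  finally show ?thesis .
qed

text \<open>
  The third equation determines \<open>x\<close> on the patch, so the existential quantifier has one possible
  witness there. Off the patch a witness is arbitrary, which the locality of the Laplacian makes
  harmless.
\<close>

lemma biharmonic_system:
  "biharmonic_on U gbar (polar_metric lam) (rot_sym_map \<rho> k) \<longleftrightarrow>
    (\<exists>x :: real ^ 2 \<Rightarrow> real. \<forall>p \<in> polar_patch I J.
         laplacian (polar_metric \<sigma>) (\<lambda>q. x q * f q) p =
           k\<^sup>2 * deriv (\<lambda>t. lam t * deriv lam t) (\<rho> (p $ 1)) / (\<sigma> (p $ 1))\<^sup>2 * (x p * f p) \<and>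
         k * partial_deriv 2 f p * deriv lam (\<rho> (p $ 1)) * x p
           / ((\<sigma> (p $ 1))\<^sup>2 * lam (\<rho> (p $ 1))) = 0 \<and>
         x p = laplacian (polar_metric \<sigma>) (\<lambda>q. \<rho> (q $ 1)) p
           - k\<^sup>2 * lam (\<rho> (p $ 1)) * deriv lam (\<rho> (p $ 1)) / (\<sigma> (p $ 1))\<^sup>2)"
  (is "?B \<longleftrightarrow> (\<exists>x. \<forall>p\<in>U. ?S x p)")
proof
  assume ?B
  then have "?S (\<lambda>q. radial_tension (q $ 1)) p" if "p \<in> U" for p
    using that laplacian_radius_eq_radial_tension[OF that]
    unfolding biharmonic_iff by (simp add: scaled_tension_def[abs_def])
  then show "\<exists>x. \<forall>p\<in>U. ?S x p" by (intro exI[of _ "\<lambda>q. radial_tension (q $ 1)"]) blast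
next
  assume "\<exists>x. \<forall>p\<in>U. ?S x p"
  then obtain x where S: "\<And>p. p \<in> U \<Longrightarrow> ?S x p" by blast
  have x: "x p = radial_tension (p $ 1)" if "p \<in> U" for p
    using S[OF that] laplacian_radius_eq_radial_tension[OF that] by simp
  have lap: "laplacian (polar_metric \<sigma>) scaled_tension p = laplacian (polar_metric \<sigma>) (\<lambda>q. x q * f q) p"
    if "p \<in> U" for p
    by (rule laplacian_cong[OF open_U that]) (simp add: x scaled_tension_def)
  show ?B
    unfolding biharmonic_iff
  proof (intro ballI conjI)
    fix p assume p: "p \<in> U"
    show "laplacian (polar_metric \<sigma>) scaled_tension p =
        k\<^sup>2 * deriv (\<lambda>t. lam t * deriv lam t) (\<rho> (p $ 1)) / (\<sigma> (p $ 1))\<^sup>2 * scaled_tension p"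
      using S[OF p, THEN conjunct1] by (simp only: lap[OF p] x[OF p] scaled_tension_def[of p])
    show "k * partial_deriv 2 f p * deriv lam (\<rho> (p $ 1)) * radial_tension (p $ 1)
               / ((\<sigma> (p $ 1))\<^sup>2 * lam (\<rho> (p $ 1))) = 0"
      using S[OF p, THEN conjunct2, THEN conjunct1] by (simp only: x[OF p])
  qed
qed

text \<open>
  Each equation at a point of the patch involves only the radial coordinate of the point, and as there
  is at least one angle, every \<open>r\<close> in \<open>I\<close> occurs.
\<close>

lemma biharmonic_system_radial:
  assumes F: "\<And>p. p \<in> U \<Longrightarrow> f p = F (p $ 1)" and J: "J \<noteq> {}"
  shows "biharmonic_on U gbar (polar_metric lam) (rot_sym_map \<rho> k) \<longleftrightarrow>
    (\<exists>x y :: real \<Rightarrow> real. \<forall>r \<in> I.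
           deriv (deriv y) r + deriv \<sigma> r / \<sigma> r * deriv y r
             - k\<^sup>2 * deriv (\<lambda>t. lam t * deriv lam t) (\<rho> r) / (\<sigma> r)\<^sup>2 * y r = 0 \<and>
           y r = F r * x r \<and>
           x r = deriv (deriv \<rho>) r + deriv \<sigma> r / \<sigma> r * deriv \<rho> r
             - k\<^sup>2 * lam (\<rho> r) * deriv lam (\<rho> r) / (\<sigma> r)\<^sup>2)"
  (is "?B \<longleftrightarrow> (\<exists>x y. \<forall>r\<in>I. ?S x y r)")
proof -
  define Y where "Y = (\<lambda>r. F r * radial_tension r)"
  have B: "?B \<longleftrightarrow> (\<forall>r\<in>I. ?S radial_tension Y r)"
  proof -
    obtain \<theta> where \<theta>: "\<theta> \<in> J" using J by blast
    have ball: "(\<forall>p\<in>U. Q (p $ 1)) \<longleftrightarrow> (\<forall>r\<in>I. Q r)" for Q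
    proof
      assume *: "\<forall>p\<in>U. Q (p $ 1)"
      show "\<forall>r\<in>I. Q r"
      proof
        fix r assume "r \<in> I"
        then have "(vector [r, \<theta>] :: real ^ 2) \<in> U" using \<theta> by (simp add: polar_patch_def)
        from bspec[OF * this] show "Q r" by simp
      qed
    qed (simp add: polar_patch_def)
    have "?B \<longleftrightarrow> (\<forall>p\<in>U. ?S radial_tension Y (p $ 1))"
      unfolding biharmonic_iff
      by (rule ball_cong[OF refl])
         (auto simp: partial_deriv_2_radial[OF F] laplacian_scaled_tension_radial[OF F]
           scaled_tension_def F Y_def radial_tension_def mult.commute[of "F _"])
    then show ?thesis using ball[of "?S radial_tension Y"] by (rule trans)
  qed
  show ?thesis
  proof
    assume ?B
    then show "\<exists>x y. \<forall>r\<in>I. ?S x y r" unfolding B by blast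
  next
    assume "\<exists>x y. \<forall>r\<in>I. ?S x y r"
    then obtain x y where S: "\<And>r. r \<in> I \<Longrightarrow> ?S x y r" by blast
    have y: "y r = Y r" if "r \<in> I" for r
      using S[OF that] by (simp add: Y_def radial_tension_def)
    have y1: "deriv y r = deriv Y r" if "r \<in> I" for r
      by (rule deriv_cong_open[OF open_I that y])
    have y2: "deriv (deriv y) r = deriv (deriv Y) r" if "r \<in> I" for r
      by (rule deriv_cong_open[OF open_I that y1])
    show ?B
      unfolding B using S y y1 y2 by (simp add: Y_def radial_tension_def)
  qed
qed

end

theorem lemma2p4:
  fixes k :: real
    and \<sigma> lam \<rho> :: "real \<Rightarrow> real"
    and f :: "real ^ 2 \<Rightarrow> real"
    and I J L P :: "real set"
  assumes "open I" "is_interval I" "I \<noteq> {}"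
    and "open J" "is_interval J" "J \<noteq> {}"
    and "open L" "is_interval L"
    and "open P" "is_interval P"
    and "smooth_on \<sigma> I" "\<And>r. r \<in> I \<Longrightarrow> \<sigma> r > 0"
    and "smooth_on lam L" "\<And>t. t \<in> L \<Longrightarrow> lam t > 0"
    and "smooth_on \<rho> I"
    and "rot_sym_map \<rho> k ` polar_patch I J \<subseteq> polar_patch L P"
    and "smooth_on f (polar_patch I J)" "\<And>p. p \<in> polar_patch I J \<Longrightarrow> f p > 0"
  shows
    "(biharmonic_on (polar_patch I J)
        (conformal_metric (\<lambda>p. inverse (f p)) (polar_metric \<sigma>)) (polar_metric lam) (rot_sym_map \<rho> k)
      \<longleftrightarrow>
      (\<exists>x :: real ^ 2 \<Rightarrow> real. \<forall>p \<in> polar_patch I J.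
         laplacian (polar_metric \<sigma>) (\<lambda>q. x q * f q) p =
           k\<^sup>2 * deriv (\<lambda>t. lam t * deriv lam t) (\<rho> (p $ 1)) / (\<sigma> (p $ 1))\<^sup>2 * (x p * f p) \<and>
         k * partial_deriv 2 f p * deriv lam (\<rho> (p $ 1)) * x p
           / ((\<sigma> (p $ 1))\<^sup>2 * lam (\<rho> (p $ 1))) = 0 \<and>
         x p = laplacian (polar_metric \<sigma>) (\<lambda>q. \<rho> (q $ 1)) p
           - k\<^sup>2 * lam (\<rho> (p $ 1)) * deriv lam (\<rho> (p $ 1)) / (\<sigma> (p $ 1))\<^sup>2))
     \<and>
     (\<forall>F :: real \<Rightarrow> real. (\<forall>p \<in> polar_patch I J. f p = F (p $ 1)) \<longrightarrow>
       (biharmonic_on (polar_patch I J)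
          (conformal_metric (\<lambda>p. inverse (f p)) (polar_metric \<sigma>)) (polar_metric lam) (rot_sym_map \<rho> k)
        \<longleftrightarrow>
        (\<exists>x y :: real \<Rightarrow> real. \<forall>r \<in> I.
           deriv (deriv y) r + deriv \<sigma> r / \<sigma> r * deriv y r
             - k\<^sup>2 * deriv (\<lambda>t. lam t * deriv lam t) (\<rho> r) / (\<sigma> r)\<^sup>2 * y r = 0 \<and>
           y r = F r * x r \<and>
           x r = deriv (deriv \<rho>) r + deriv \<sigma> r / \<sigma> r * deriv \<rho> r
             - k\<^sup>2 * lam (\<rho> r) * deriv lam (\<rho> r) / (\<sigma> r)\<^sup>2)))"
proof -
  interpret rotationally_symmetric_map k \<sigma> lam \<rho> f I J L
  proof
    fix r assume r: "r \<in> I"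
    obtain \<theta> where "\<theta> \<in> J" using assms(6) by blast
    with r have "rot_sym_map \<rho> k (vector [r, \<theta>]) \<in> polar_patch L P"
      by (intro subsetD[OF assms(16)] imageI) (simp add: polar_patch_def)
    then show "\<rho> r \<in> L" by (simp add: rot_sym_map_def polar_patch_def)
  qed (use assms in auto)
  show ?thesis
    using biharmonic_system biharmonic_system_radial[OF _ assms(6)] by simp
qed

end
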